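(* Let $(X,d)$ be a locally compact metric space with group of isometries $G$. Let $\{g_i\}_{i\in I}$ be a net in $G$ and let $x,y\in X$ be such that $g_i x$ converges to $y$. Then there exist a subnet $\{g_j\}$ of $\{g_i\}$ and an isometry $f:C_x\to X$ such that $g_j$ converges to $f$ pointwise on $C_x$ and $f(C_x)=C_{f(x)}$, where $C_z$ denotes the pseudo-component of a point $z\in X$.
   Context: $G$ is the group of all surjective distance-preserving maps $X\to X$. An isometry $f:A\to X$ defined on a subset $A\subset X$ means a distance-preserving map (not necessarily surjective onto $X$). For $u\in X$ and $r>0$, $B_r(u)$ denotes the open ball $\{v\in X : d(u,v)<r\}$. Pseudo-components (a notion of Gao and Kechris): say that $u$ can be connected to $v$ if there are finitely many points $u=u_0,u_1,\dots,u_n=v$ in $X$ and radii $r_0,\dots,r_{n-1}>0$ such that, for each $0\le k<n$, the ball $B_{r_k}(u_k)$ has compact closure in $X$ and $u_{k+1}\in B_{r_k}(u_k)$. Define $u\sim v$ if and only if $u$ can be connected to $v$ and $v$ can be connected to $u$. This is an equivalence relation on $X$; its equivalence classes are called pseudo-components, and $C_u$ denotes the equivalence class of $u$. *)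

theory Defs
  imports "HOL-Analysis.Analysis"
begin

definition isometry_on :: "'a::metric_space set \<Rightarrow> ('a \<Rightarrow> 'a) \<Rightarrow> bool" where
  "isometry_on A f \<longleftrightarrow> (\<forall>u\<in>A. \<forall>v\<in>A. dist (f u) (f v) = dist u v)"

definition isometry_group :: "('a::metric_space \<Rightarrow> 'a) set" where
  "isometry_group = {g. isometry_on UNIV g \<and> surj g}"

definition connectable :: "'a::metric_space \<Rightarrow> 'a \<Rightarrow> bool" where
  "connectable u v \<longleftrightarrow> (\<exists>(n::nat) (p::nat \<Rightarrow> 'a) (r::nat \<Rightarrow> real).
     p 0 = u \<and> p n = v \<and>
     (\<forall>k<n. r k > 0 \<and> compact (closure (ball (p k) (r k))) \<and> p (Suc k) \<in> ball (p k) (r k)))"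

definition pseudo_equiv :: "('a::metric_space \<times> 'a) set" where
  "pseudo_equiv = {(u, v). connectable u v \<and> connectable v u}"

definition pseudo_component :: "'a::metric_space \<Rightarrow> 'a set" where
  "pseudo_component u = pseudo_equiv `` {u}"

lemma connectable_refl: "connectable u u"
  unfolding connectable_def by (rule exI[of _ 0]) auto

lemma connectable_trans:
  assumes "connectable u v" and "connectable v w"
  shows "connectable u w"
proof -
  obtain n p r where 1: "p 0 = u" "p n = v"
    "\<forall>k<n. r k > 0 \<and> compact (closure (ball (p k) (r k))) \<and> p (Suc k) \<in> ball (p k) (r k)"
    using assms(1) unfolding connectable_def by blast
  obtain m q s where 2: "q 0 = v" "q m = w"
    "\<forall>k<m. s k > 0 \<and> compact (closure (ball (q k) (s k))) \<and> q (Suc k) \<in> ball (q k) (s k)"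
    using assms(2) unfolding connectable_def by blast
  define p' where "p' = (\<lambda>k. if k < n then p k else q (k - n))"
  define r' where "r' = (\<lambda>k. if k < n then r k else s (k - n))"
  have step: "r' k > 0 \<and> compact (closure (ball (p' k) (r' k))) \<and> p' (Suc k) \<in> ball (p' k) (r' k)"
    if k: "k < n + m" for k
  proof (cases "k < n")
    case True
    have "p' (Suc k) = p (Suc k)"
    proof (cases "Suc k < n")
      case False
      then have "Suc k = n" using True by simp
      then show ?thesis using 1(2) 2(1) by (simp add: p'_def)
    qed (simp add: p'_def)
    then show ?thesis using 1(3) True by (simp add: p'_def r'_def)
  next
    case False
    then have "k - n < m" using k by simp
    then show ?thesis using 2(3) False by (simp add: p'_def r'_def Suc_diff_le)
  qed
  have "p' 0 = u" using 1(1,2) 2(1) by (cases "n = 0") (auto simp: p'_def)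
  moreover have "p' (n + m) = w" using 2(2) by (simp add: p'_def)
  ultimately show ?thesis
    unfolding connectable_def using step by blast
qed

lemma equiv_pseudo_equiv: "equiv UNIV pseudo_equiv"
  by (rule equivI)
    (auto simp: pseudo_equiv_def refl_on_def sym_def trans_def
      intro: connectable_refl connectable_trans)

definition directed_preorder :: "'i set \<Rightarrow> ('i \<Rightarrow> 'i \<Rightarrow> bool) \<Rightarrow> bool" where
  "directed_preorder I le \<longleftrightarrow> I \<noteq> {} \<and>
     (\<forall>i\<in>I. le i i) \<and>
     (\<forall>i\<in>I. \<forall>j\<in>I. \<forall>k\<in>I. le i j \<longrightarrow> le j k \<longrightarrow> le i k) \<and>
     (\<forall>i\<in>I. \<forall>j\<in>I. \<exists>k\<in>I. le i k \<and> le j k)"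

(* The filter of tails: convergence of a net indexed by I is tendsto along this filter. *)
definition net_filter :: "'i set \<Rightarrow> ('i \<Rightarrow> 'i \<Rightarrow> bool) \<Rightarrow> 'i filter" where
  "net_filter I le = (INF i\<in>I. principal {j \<in> I. le i j})"

lemma eventually_net_filter:
  assumes "directed_preorder I le"
  shows "eventually P (net_filter I le) \<longleftrightarrow> (\<exists>i\<in>I. \<forall>j\<in>I. le i j \<longrightarrow> P j)"
proof -
  have "\<exists>x\<in>I. principal {j \<in> I. le x j} \<le>
      inf (principal {j \<in> I. le a j}) (principal {j \<in> I. le b j})"
    if a: "a \<in> I" and b: "b \<in> I" for a b
  proof -
    obtain k where k: "k \<in> I" "le a k" "le b k"
      using assms a b unfolding directed_preorder_def by blast
    moreover have "le a j \<and> le b j" if "j \<in> I" "le k j" for j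
      using assms a b k that unfolding directed_preorder_def by blast
    ultimately show ?thesis by (intro bexI[of _ k]) auto
  qed
  moreover have "I \<noteq> {}" using assms by (simp add: directed_preorder_def)
  ultimately show ?thesis
    unfolding net_filter_def by (subst eventually_INF_base) (auto simp: eventually_principal)
qed

(* Reindexing along a monotone map with cofinal image (Willard's notion of subnet).
   Every such subnet is also a subnet in the weaker sense of Kelley. *)
definition subnet_map ::
    "'j set \<Rightarrow> ('j \<Rightarrow> 'j \<Rightarrow> bool) \<Rightarrow> 'i set \<Rightarrow> ('i \<Rightarrow> 'i \<Rightarrow> bool) \<Rightarrow> ('j \<Rightarrow> 'i) \<Rightarrow> bool" where
  "subnet_map J leJ I leI h \<longleftrightarrow> h ` J \<subseteq> I \<and>
     (\<forall>a\<in>J. \<forall>b\<in>J. leJ a b \<longrightarrow> leI (h a) (h b)) \<and>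
     (\<forall>i\<in>I. \<exists>j\<in>J. leI i (h j))"

(* Types cannot be quantified existentially, so the index set of a subnet of a net indexed by
   elements of 'i is taken in this type, which is large enough for the index set
   {(i, A). i \<in> A \<and> A \<in> U}, U an ultrafilter on the index set, of a universal subnet. *)
type_synonym 'i subnet_index = "'i \<times> 'i set"

end

(* Pass to a universal subnet, that is, to an ultrafilter F refining the tail filter of the net.
   If g_i z converges along F to w and B_r(z) has compact closure, then so does B_s(w) for every
   s < r, because B_s(w) lies in the ball g_i B_r(z) for late i; hence g_i v, which is eventually
   in such a ball, converges along F for every v in B_r(z). Walking along chains, the limit f
   exists at all points that can be connected from x, and it maps chains to chains.
   As g_i^{-1} y tends to x, the same applies to the inverses, whose limit is a right inverse
   of f on the pseudo-component of y = f x. *)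
theory Submission
  imports Defs
begin

section \<open>Ultrafilters\<close>

definition ultrafilter :: "'a filter \<Rightarrow> bool" where
  "ultrafilter F \<longleftrightarrow> F \<noteq> bot \<and> (\<forall>P. eventually P F \<or> eventually (\<lambda>x. \<not> P x) F)"

text \<open>Zorn's lemma on the proper filters below \<open>F\<close>. In the order of filters finer
  means smaller, so a minimal element is sought, and \<open>relation_of (\<ge>) A\<close> turns it
  into a maximal one.\<close>

lemma ultrafilter_exists:
  fixes F :: "'a filter"
  assumes "F \<noteq> bot"
  obtains U where "U \<le> F" "ultrafilter U"
proof -
  define A where "A = {G. G \<noteq> bot \<and> G \<le> F}"
  have po: "partial_order_on A (relation_of (\<ge>) A)"
    by (auto simp: partial_order_on_def preorder_on_def refl_on_def trans_def antisym_def
        relation_of_def)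
  have chain: "\<exists>u\<in>A. \<forall>a\<in>C. u \<le> a" if C: "C \<in> Chains (relation_of (\<ge>) A)" for C
  proof (cases "C = {}")
    case True
    then show ?thesis using assms by (auto simp: A_def)
  next
    case False
    have CA: "C \<subseteq> A" and lin: "\<And>a b. a \<in> C \<Longrightarrow> b \<in> C \<Longrightarrow> a \<le> b \<or> b \<le> a"
      using C by (auto simp: Chains_def relation_of_def)
    \<comment> \<open>In a chain \<open>inf a b\<close> is \<open>a\<close> or \<open>b\<close>, so
      the chain is a filter base: what holds eventually in \<open>Inf C\<close> already does in one
      proper member.\<close>
    have "\<exists>c\<in>C. c \<le> inf a b" if "a \<in> C" "b \<in> C" for a b
      using lin[OF that] that by auto
    then have "eventually P (Inf C) \<longleftrightarrow> (\<exists>c\<in>C. eventually P c)" for P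
      using False by (intro eventually_Inf_base) auto
    then have "Inf C \<noteq> bot"
      using CA by (auto simp: A_def trivial_limit_def)
    moreover obtain c where "c \<in> C" using False by blast
    ultimately have "Inf C \<in> A"
      using CA by (auto simp: A_def intro: order_trans[OF Inf_lower])
    then show ?thesis by (blast intro: Inf_lower)
  qed
  obtain U where U: "U \<in> A" and max: "\<And>G. G \<in> A \<Longrightarrow> G \<le> U \<Longrightarrow> G = U"
    using predicate_Zorn[OF po chain] by blast
  have "eventually P U \<or> eventually (\<lambda>x. \<not> P x) U" for P
  \<comment> \<open>Restricting \<open>U\<close> to \<open>P\<close> either gives the improper
    filter, so that \<open>P\<close> eventually fails, or by minimality gives back
    \<open>U\<close>.\<close>
  proof (cases "inf U (principal {x. P x}) = bot")
    case True
    then show ?thesis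
      by (simp add: trivial_limit_def eventually_inf_principal)
  next
    case False
    have "inf U (principal {x. P x}) \<in> A"
      using False U by (auto simp: A_def intro: le_infI1)
    then have "inf U (principal {x. P x}) = U" by (intro max) auto
    moreover have "eventually P (inf U (principal {x. P x}))"
      by (simp add: eventually_inf_principal)
    ultimately show ?thesis by simp
  qed
  with U show ?thesis
    by (intro that[of U]) (auto simp: A_def ultrafilter_def)
qed

text \<open>Compactness yields a cluster point of the image filter. An ultrafilter converges to its
  cluster points, since a neighbourhood that is not eventually entered is eventually
  avoided.\<close>

lemma ultrafilter_tendsto_compact:
  fixes X :: "'i \<Rightarrow> 'a::topological_space"
  assumes "ultrafilter F" and "compact K" and ev: "eventually (\<lambda>i. X i \<in> K) F"
  obtains l where "(X \<longlongrightarrow> l) F"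
proof -
  have "filtermap X F \<noteq> bot"
    using assms(1) by (simp add: ultrafilter_def filtermap_bot_iff)
  moreover have "eventually (\<lambda>u. u \<in> K) (filtermap X F)"
    using ev by (simp add: eventually_filtermap)
  ultimately obtain l where l: "inf (nhds l) (filtermap X F) \<noteq> bot"
    using assms(2) unfolding compact_filter by blast
  have "eventually (\<lambda>i. X i \<in> S) F" if "open S" "l \<in> S" for S
  proof (rule ccontr)
    assume "\<not> eventually (\<lambda>i. X i \<in> S) F"
    then have "eventually (\<lambda>i. X i \<notin> S) F"
      using assms(1) by (auto simp: ultrafilter_def)
    moreover have "eventually (\<lambda>u. u \<in> S) (nhds l)"
      using that by (rule eventually_nhds_in_open)
    ultimately have "eventually (\<lambda>_. False) (inf (nhds l) (filtermap X F))"
      unfolding eventually_inf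
      by (intro exI[of _ "\<lambda>u. u \<in> S"] exI[of _ "\<lambda>u. u \<notin> S"]) (auto simp: eventually_filtermap)
    with l show False by (simp add: trivial_limit_def)
  qed
  then have "(X \<longlongrightarrow> l) F" by (rule topological_tendstoI)
  then show ?thesis by (rule that)
qed

text \<open>The indices are pairs \<open>(i, A)\<close> with \<open>i\<close> in a member
  \<open>A\<close> of \<open>F\<close>. The first coordinate makes \<open>fst\<close> monotone;
  shrinking the second forces the tails of \<open>J\<close> into every member of
  \<open>F\<close>.\<close>

lemma subnet_of_filter:
  fixes I :: "'i set"
  assumes dir: "directed_preorder I leI" and F: "F \<noteq> bot" "F \<le> net_filter I leI"
  obtains J :: "'i subnet_index set" and leJ where
    "directed_preorder J leJ" "subnet_map J leJ I leI fst" "filtermap fst (net_filter J leJ) \<le> F"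
proof -
  define J where "J = {(i, A). i \<in> A \<and> A \<subseteq> I \<and> eventually (\<lambda>i. i \<in> A) F}"
  define leJ where "leJ = (\<lambda>p q :: 'i subnet_index. leI (fst p) (fst q) \<and> snd q \<subseteq> snd p)"
  have tail: "eventually (\<lambda>j. j \<in> I \<and> leI i j) F" if "i \<in> I" for i
  proof (rule filter_leD[OF F(2)])
    show "eventually (\<lambda>j. j \<in> I \<and> leI i j) (net_filter I leI)"
      unfolding eventually_net_filter[OF dir] using that by blast
  qed
  have refl: "leI i i" if "i \<in> I" for i
    using dir that by (simp add: directed_preorder_def)
  have trans: "leI i k" if "i \<in> I" "j \<in> I" "k \<in> I" "leI i j" "leI j k" for i j k
    using dir that unfolding directed_preorder_def by blast
  obtain i0 where i0: "i0 \<in> I" using dir by (auto simp: directed_preorder_def)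
  have evI: "eventually (\<lambda>j. j \<in> I) F"
    using tail[OF i0] by (rule eventually_mono) auto
  have dirJ: "directed_preorder J leJ"
    unfolding directed_preorder_def
  proof (intro conjI ballI impI)
    show "J \<noteq> {}" using i0 evI by (auto simp: J_def)
    show "leJ p p" if "p \<in> J" for p
      using that refl by (auto simp: J_def leJ_def)
    show "leJ p r" if "p \<in> J" "q \<in> J" "r \<in> J" "leJ p q" "leJ q r" for p q r
    proof -
      have "fst p \<in> I" "fst q \<in> I" "fst r \<in> I" using that by (auto simp: J_def)
      then show ?thesis using that(4,5) trans unfolding leJ_def by blast
    qed
    show "\<exists>r\<in>J. leJ p r \<and> leJ q r" if "p \<in> J" "q \<in> J" for p q
    proof -
      define A where "A = snd p \<inter> snd q"
      have p: "fst p \<in> I" "eventually (\<lambda>i. i \<in> snd p) F" "snd p \<subseteq> I"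
        and q: "fst q \<in> I" "eventually (\<lambda>i. i \<in> snd q) F"
        using that by (auto simp: J_def)
      have A: "eventually (\<lambda>i. i \<in> A) F"
        using p(2) q(2) unfolding A_def by eventually_elim auto
      \<comment> \<open>The tails of \<open>I\<close> belong to \<open>F\<close>, so they meet
        \<open>A\<close> in a member of \<open>F\<close>, which is nonempty.\<close>
      have "eventually (\<lambda>k. k \<in> A \<and> leI (fst p) k \<and> leI (fst q) k) F"
        using A tail[OF p(1)] tail[OF q(1)] by eventually_elim auto
      then obtain k where "k \<in> A" "leI (fst p) k" "leI (fst q) k"
        using F(1) eventually_happens' by blast
      then show ?thesis
        using A p(3) by (intro bexI[of _ "(k, A)"]) (auto simp: J_def leJ_def A_def)
    qed
  qed
  moreover have "subnet_map J leJ I leI fst"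
  proof -
    have "\<exists>j\<in>J. leI i (fst j)" if "i \<in> I" for i
      using that evI refl by (intro bexI[of _ "(i, I)"]) (auto simp: J_def)
    then show ?thesis
      by (auto simp: subnet_map_def J_def leJ_def)
  qed
  moreover have "filtermap fst (net_filter J leJ) \<le> F"
  proof (rule filter_leI)
    fix P assume P: "eventually P F"
    define A where "A = {i \<in> I. P i}"
    have A: "eventually (\<lambda>i. i \<in> A) F"
      using P evI unfolding A_def by eventually_elim auto
    obtain i where "i \<in> A"
      using A F(1) eventually_happens' by blast
    \<comment> \<open>Beyond \<open>(i, A)\<close> all second coordinates lie in \<open>A\<close>,
      hence all first coordinates satisfy \<open>P\<close>.\<close>
    then have "(i, A) \<in> J" using A by (auto simp: J_def A_def)
    moreover have "P (fst q)" if "q \<in> J" "leJ (i, A) q" for q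
      using that by (auto simp: J_def leJ_def A_def)
    ultimately show "eventually P (filtermap fst (net_filter J leJ))"
      unfolding eventually_filtermap eventually_net_filter[OF dirJ] by blast
  qed
  ultimately show ?thesis by (rule that)
qed

section \<open>Isometries\<close>

lemma isometry_group_dist: "g \<in> isometry_group \<Longrightarrow> dist (g u) (g v) = dist u v"
  by (simp add: isometry_group_def isometry_on_def)

lemma isometry_group_bij:
  assumes "g \<in> isometry_group"
  shows "bij g"
proof (rule bijI)
  show "inj g"
  proof (rule injI)
    fix u v assume "g u = g v"
    then have "dist u v = 0" using isometry_group_dist[OF assms, of u v] by simp
    then show "u = v" by simp
  qed
  show "surj g" using assms by (simp add: isometry_group_def)
qed

lemma isometry_group_inv:
  assumes "g \<in> isometry_group"
  shows "inv g \<in> isometry_group" "g (inv g u) = u" "inv g (g u) = u"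
    "dist (inv g u) v = dist u (g v)"
proof -
  have b: "bij g" using assms by (rule isometry_group_bij)
  then show 1: "g (inv g u) = u" "inv g (g u) = u" for u
    by (simp_all add: bij_is_surj surj_f_inv_f bij_is_inj inv_f_f)
  show 2: "dist (inv g u) v = dist u (g v)" for u v
    using isometry_group_dist[OF assms, of "inv g u" v] 1 by simp
  show "inv g \<in> isometry_group"
    using b 1 2 by (simp add: isometry_group_def isometry_on_def bij_imp_bij_inv bij_is_surj)
qed

lemma isometry_group_compact_image:
  assumes "g \<in> isometry_group" and "compact K"
  shows "compact (g ` K)"
proof (rule compact_continuous_image[OF _ assms(2)])
  show "continuous_on K g"
    unfolding continuous_on_iff using isometry_group_dist[OF assms(1)] by auto
qed

lemma limit_dist_eq:
  assumes "F \<noteq> bot" and "eventually (\<lambda>i. g i \<in> isometry_group) F"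
    and "((\<lambda>i. g i u) \<longlongrightarrow> u') F" and "((\<lambda>i. g i v) \<longlongrightarrow> v') F"
  shows "dist u' v' = dist u v"
proof -
  have "((\<lambda>i. dist (g i u) (g i v)) \<longlongrightarrow> dist u' v') F"
    using assms(3,4) by (rule tendsto_dist)
  moreover have "((\<lambda>i. dist (g i u) (g i v)) \<longlongrightarrow> dist u v) F"
    using assms(2)
    by (intro tendsto_eventually) (auto elim!: eventually_mono simp: isometry_group_dist)
  ultimately show ?thesis
    using assms(1) tendsto_unique by blast
qed

text \<open>Both sides say that the same real numbers \<open>dist (g i z) w\<close> tend to 0. This
  lets results about limits of isometries be used for the inverses too.\<close>

lemma tendsto_inv_isometry_iff:
  assumes "eventually (\<lambda>i. g i \<in> isometry_group) F"
  shows "((\<lambda>i. inv (g i) w) \<longlongrightarrow> z) F \<longleftrightarrow> ((\<lambda>i. g i z) \<longlongrightarrow> w) F"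
proof -
  have "eventually (\<lambda>i. dist (inv (g i) w) z = dist (g i z) w) F"
    using assms by eventually_elim (metis isometry_group_inv(4) dist_commute)
  then show ?thesis
    unfolding tendsto_dist_iff[of "\<lambda>i. inv (g i) w"] tendsto_dist_iff[of "\<lambda>i. g i z"]
    by (rule tendsto_cong)
qed

section \<open>Limits of isometries along chains of relatively compact balls\<close>

text \<open>A single isometry \<open>g i\<close> with \<open>g i z\<close> closer to
  \<open>w\<close> than \<open>r - s\<close> suffices: it maps the ball of radius \<open>r\<close>
  about \<open>z\<close> onto a ball containing \<open>ball w s\<close>.\<close>

lemma compact_ball_at_limit:
  assumes "F \<noteq> bot" and "eventually (\<lambda>i. g i \<in> isometry_group) F"
    and "((\<lambda>i. g i z) \<longlongrightarrow> w) F" and "compact (closure (ball z r))" and "s < r"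
  shows "compact (closure (ball w s))"
proof -
  have "eventually (\<lambda>i. dist (g i z) w < r - s) F"
    using assms(3,5) by (intro tendstoD) auto
  then have "eventually (\<lambda>i. dist (g i z) w < r - s \<and> g i \<in> isometry_group) F"
    using assms(2) by (rule eventually_conj)
  then obtain i where i: "dist (g i z) w < r - s" "g i \<in> isometry_group"
    using assms(1) eventually_happens' by blast
  have K: "compact (g i ` closure (ball z r))"
    using i(2) assms(4) by (rule isometry_group_compact_image)
  have "ball w s \<subseteq> g i ` closure (ball z r)"
  proof
    fix u assume u: "u \<in> ball w s"
    have "dist z (inv (g i) u) = dist (g i z) u"
      using isometry_group_inv(4)[OF i(2), of u z] by (simp add: dist_commute)
    also have "\<dots> < r"
      using u i(1) dist_triangle[of "g i z" u w] by simp
    finally have "inv (g i) u \<in> closure (ball z r)"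
      using closure_subset[of "ball z r"] by auto
    moreover have "u = g i (inv (g i) u)"
      using isometry_group_inv(2)[OF i(2)] by simp
    ultimately show "u \<in> g i ` closure (ball z r)" by blast
  qed
  then have "closure (ball w s) \<subseteq> g i ` closure (ball z r)"
    using K by (simp add: closure_minimal compact_imp_closed)
  then show ?thesis
    using compact_Int_closed[OF K closed_closure, of "ball w s"] by (simp add: Int_absorb1)
qed

lemma limit_exists_in_ball:
  assumes "ultrafilter F" and "eventually (\<lambda>i. g i \<in> isometry_group) F"
    and lim: "((\<lambda>i. g i z) \<longlongrightarrow> w) F" and "compact (closure (ball z r))" and v: "v \<in> ball z r"
  obtains l where "((\<lambda>i. g i v) \<longlongrightarrow> l) F"
proof -
  \<comment> \<open>The gap below \<open>r\<close> keeps \<open>ball w s\<close> relatively compact;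
    the gap above \<open>dist z v\<close> absorbs the distance from \<open>g i z\<close> to
    \<open>w\<close>.\<close>
  obtain s where s: "dist z v < s" "s < r" using v dense by auto
  have K: "compact (closure (ball w s))"
    using assms s by (intro compact_ball_at_limit[of F g z w r s]) (auto simp: ultrafilter_def)
  have "eventually (\<lambda>i. dist (g i z) w < s - dist z v) F"
    using lim s by (intro tendstoD) auto
  then have "eventually (\<lambda>i. g i v \<in> closure (ball w s)) F"
    using assms(2)
  proof eventually_elim
    case (elim i)
    have "dist w (g i v) \<le> dist (g i z) w + dist (g i z) (g i v)"
      by (metis dist_commute dist_triangle)
    then have "g i v \<in> ball w s"
      using elim isometry_group_dist[OF elim(2), of z v] by simp
    then show ?case using closure_subset by blast
  qed
  then show ?thesis
    using ultrafilter_tendsto_compact[OF assms(1) K, of "\<lambda>i. g i v"] that by blast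
qed

text \<open>Induction along the chain: each limit provides the relatively compact ball in which the
  next one is found, and limits of consecutive points keep their distance, so they form a chain from
  \<open>u'\<close>.\<close>

lemma connectable_limit:
  assumes U: "ultrafilter F" and iso: "eventually (\<lambda>i. g i \<in> isometry_group) F"
    and "((\<lambda>i. g i u) \<longlongrightarrow> u') F" and "connectable u v"
  obtains v' where "((\<lambda>i. g i v) \<longlongrightarrow> v') F" "connectable u' v'"
proof -
  have nb: "F \<noteq> bot" using U by (simp add: ultrafilter_def)
  obtain n p r where p: "p 0 = u" "p n = v" and
    step: "\<And>k. k < n \<Longrightarrow> r k > 0 \<and> compact (closure (ball (p k) (r k))) \<and> p (Suc k) \<in> ball (p k) (r k)"
    using assms(4) unfolding connectable_def by blast
  have "\<exists>l. ((\<lambda>i. g i (p k)) \<longlongrightarrow> l) F \<and> connectable u' l" if "k \<le> n" for k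
    using that
  proof (induction k)
    case 0
    then show ?case using assms(3) p(1) connectable_refl by blast
  next
    case (Suc k)
    then obtain l where l: "((\<lambda>i. g i (p k)) \<longlongrightarrow> l) F" "connectable u' l" by auto
    have c: "compact (closure (ball (p k) (r k)))" "p (Suc k) \<in> ball (p k) (r k)"
      using step[of k] Suc.prems by auto
    obtain m where m: "((\<lambda>i. g i (p (Suc k))) \<longlongrightarrow> m) F"
      using limit_exists_in_ball[OF U iso l(1) c] .
    \<comment> \<open>The radius must shrink below \<open>r k\<close> for compactness at the limit
      \<open>l\<close>, yet still reach \<open>m\<close>.\<close>
    obtain s where s: "dist (p k) (p (Suc k)) < s" "s < r k" using c(2) dense by auto
    have "m \<in> ball l s"
      using limit_dist_eq[OF nb iso l(1) m] s(1) by simp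
    moreover have "compact (closure (ball l s))"
      using nb iso l(1) c(1) s(2) by (rule compact_ball_at_limit)
    moreover have "0 < s" using s(1) zero_le_dist[of "p k" "p (Suc k)"] by linarith
    ultimately have "connectable l m"
      unfolding connectable_def
      by (intro exI[of _ 1] exI[of _ "\<lambda>k. if k = 0 then l else m"] exI[of _ "\<lambda>_. s"]) auto
    then show ?case using m l(2) connectable_trans by blast
  qed
  from this[of n] show ?thesis using p(2) that by auto
qed

text \<open>Follow a chain from \<open>u\<close> to \<open>v\<close> and then one back: limits are
  unique, so the way back from \<open>v'\<close> ends at \<open>u'\<close> again.\<close>

lemma pseudo_component_limit:
  assumes U: "ultrafilter F" and iso: "eventually (\<lambda>i. g i \<in> isometry_group) F"
    and u: "((\<lambda>i. g i u) \<longlongrightarrow> u') F" and v: "v \<in> pseudo_component u"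
  obtains v' where "((\<lambda>i. g i v) \<longlongrightarrow> v') F" "v' \<in> pseudo_component u'"
proof -
  have nb: "F \<noteq> bot" using U by (simp add: ultrafilter_def)
  have uv: "connectable u v" "connectable v u"
    using v by (auto simp: pseudo_component_def pseudo_equiv_def)
  obtain v' where v': "((\<lambda>i. g i v) \<longlongrightarrow> v') F" "connectable u' v'"
    using connectable_limit[OF U iso u uv(1)] .
  obtain u'' where u'': "((\<lambda>i. g i u) \<longlongrightarrow> u'') F" "connectable v' u''"
    using connectable_limit[OF U iso v'(1) uv(2)] .
  have "u'' = u'" using tendsto_unique[OF nb u''(1) u] .
  with v' u'' show ?thesis
    by (intro that) (auto simp: pseudo_component_def pseudo_equiv_def)
qed

theorem theorem1p3:
  fixes g :: "'i \<Rightarrow> 'a::metric_space \<Rightarrow> 'a"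
    and I :: "'i set" and leI :: "'i \<Rightarrow> 'i \<Rightarrow> bool"
    and x y :: 'a
  assumes "locally_compact_space (euclidean :: 'a topology)"
    and "directed_preorder I leI"
    and "\<And>i. i \<in> I \<Longrightarrow> g i \<in> isometry_group"
    and "((\<lambda>i. g i x) \<longlongrightarrow> y) (net_filter I leI)"
  shows "\<exists>(J :: 'i subnet_index set) leJ (h :: 'i subnet_index \<Rightarrow> 'i) (f :: 'a \<Rightarrow> 'a).
    directed_preorder J leJ \<and> subnet_map J leJ I leI h \<and>
    isometry_on (pseudo_component x) f \<and>
    (\<forall>z\<in>pseudo_component x. ((\<lambda>j. g (h j) z) \<longlongrightarrow> f z) (net_filter J leJ)) \<and>
    f ` pseudo_component x = pseudo_component (f x)"
proof -
  have I: "I \<noteq> {}" "\<And>i. i \<in> I \<Longrightarrow> leI i i"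
    using assms(2) by (simp_all add: directed_preorder_def)
  \<comment> \<open>By reflexivity each tail contains its own starting index.\<close>
  have "net_filter I leI \<noteq> bot"
    unfolding trivial_limit_def eventually_net_filter[OF assms(2)] using I(2) by blast
  then obtain F where F: "F \<le> net_filter I leI" "ultrafilter F"
    using ultrafilter_exists by blast
  then have nb: "F \<noteq> bot" by (simp add: ultrafilter_def)
  have "eventually (\<lambda>i. g i \<in> isometry_group) (net_filter I leI)"
    unfolding eventually_net_filter[OF assms(2)] using I(1) assms(3) by blast
  then have iso: "eventually (\<lambda>i. g i \<in> isometry_group) F"
    using F(1) by (rule filter_leD[rotated])
  then have iso_inv: "eventually (\<lambda>i. inv (g i) \<in> isometry_group) F"
    by eventually_elim (rule isometry_group_inv)
  have x: "((\<lambda>i. g i x) \<longlongrightarrow> y) F"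
    using F(1) assms(4) by (rule tendsto_mono)
  then have y: "((\<lambda>i. inv (g i) y) \<longlongrightarrow> x) F"
    by (simp add: tendsto_inv_isometry_iff[OF iso])
  \<comment> \<open>\<open>Lim\<close> is a meaningful value only where the limit exists; on
    \<open>pseudo_component x\<close> this is ensured below.\<close>
  define f where "f = (\<lambda>z. Lim F (\<lambda>i. g i z))"
  have f_eq: "f z = w" if "((\<lambda>i. g i z) \<longlongrightarrow> w) F" for z w
    unfolding f_def using nb that by (rule tendsto_Lim)
  have f: "((\<lambda>i. g i z) \<longlongrightarrow> f z) F" "f z \<in> pseudo_component y" if z: "z \<in> pseudo_component x" for z
  proof -
    obtain w where w: "((\<lambda>i. g i z) \<longlongrightarrow> w) F" "w \<in> pseudo_component y"
      using pseudo_component_limit[OF F(2) iso x z] .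
    then show "((\<lambda>i. g i z) \<longlongrightarrow> f z) F" "f z \<in> pseudo_component y"
      using f_eq[OF w(1)] by simp_all
  qed
  have onto: "\<exists>z\<in>pseudo_component x. f z = w" if w: "w \<in> pseudo_component y" for w
  proof -
    \<comment> \<open>The preimage of \<open>w\<close> is the limit of its preimages under the
      \<open>g i\<close>, obtained with the roles of \<open>x\<close> and \<open>y\<close>
      exchanged.\<close>
    obtain z where z: "((\<lambda>i. inv (g i) w) \<longlongrightarrow> z) F" "z \<in> pseudo_component x"
      using pseudo_component_limit[OF F(2) iso_inv y w] .
    then show ?thesis
      using f_eq tendsto_inv_isometry_iff[OF iso] by blast
  qed
  have "f ` pseudo_component x = pseudo_component (f x)"
    unfolding f_eq[OF x] using f(2) onto by blast
  moreover have "isometry_on (pseudo_component x) f"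
    unfolding isometry_on_def using limit_dist_eq[OF nb iso f(1) f(1)] by blast
  moreover obtain J :: "'i subnet_index set" and leJ where J: "directed_preorder J leJ" "subnet_map J leJ I leI fst"
    and le: "filtermap fst (net_filter J leJ) \<le> F"
    using subnet_of_filter[OF assms(2) nb F(1)] .
  \<comment> \<open>The tail filter of the subnet, pushed to \<open>I\<close> by \<open>fst\<close>,
    refines \<open>F\<close>, so limits along \<open>F\<close> persist.\<close>
  moreover have "((\<lambda>j. g (fst j) z) \<longlongrightarrow> f z) (net_filter J leJ)" if "z \<in> pseudo_component x" for z
    using tendsto_mono[OF le f(1)[OF that]] by (simp add: filterlim_def filtermap_filtermap)
  ultimately show ?thesis by blast
qed

end
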